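(* Let $\mathcal{A},\mathcal{B}$ be finite non-empty subsets of ${\bf\Sigma}^0_1(\mathcal{N})$. Then the posets $L^\ast(\mathcal{A})$ and $L^\ast(\mathcal{B})$ are isomorphic iff the posets $(\mathcal{A};\subseteq)$ and $(\mathcal{B};\subseteq)$ are isomorphic.
   Context: $\mathcal{N}=\omega^\omega$ is the Baire space and ${\bf\Sigma}^0_1(\mathcal{N})$ its set of open subsets. A ${\bf\Sigma}^0_1$-TR is a function $\nu:\mathcal{N}\to{\bf\Sigma}^0_1(\mathcal{N})$ whose universal set $\{(a,x)\mid x\in\nu(a)\}$ is open in $\mathcal{N}\times\mathcal{N}$. For TRs, $\mu\leq\nu$ iff $\mu=\nu\circ f$ for some continuous $f:\mathcal{N}\to\mathcal{N}$. For $\mathcal{A}\subseteq{\bf\Sigma}^0_1(\mathcal{N})$, $\mathcal{L}^\ast(\mathcal{A})$ is the set of all ${\bf\Sigma}^0_1$-TRs $\nu$ with values in $\mathcal{A}$ (not necessarily onto $\mathcal{A}$), and $L^\ast(\mathcal{A})$ is the quotient poset of the preorder $(\mathcal{L}^\ast(\mathcal{A});\leq)$. *)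

theory Defs
  imports "HOL-Analysis.Function_Topology"
begin

text \<open>The topology on \<^typ>\<open>nat \<Rightarrow> nat\<close> is the library's product topology, with \<^typ>\<open>nat\<close>
  discrete.\<close>

type_synonym baire = "nat \<Rightarrow> nat"

definition is_Sigma01_TR :: "(baire \<Rightarrow> baire set) \<Rightarrow> bool" where
  "is_Sigma01_TR \<nu> \<longleftrightarrow> (\<forall>a. open (\<nu> a)) \<and> open {(a, x). x \<in> \<nu> a}"

definition tr_le :: "(baire \<Rightarrow> baire set) \<Rightarrow> (baire \<Rightarrow> baire set) \<Rightarrow> bool" where
  "tr_le \<mu> \<nu> \<longleftrightarrow> (\<exists>f :: baire \<Rightarrow> baire. continuous_on UNIV f \<and> \<mu> = \<nu> \<circ> f)"

definition TRs_into :: "baire set set \<Rightarrow> (baire \<Rightarrow> baire set) set" where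
  "TRs_into \<A> = {\<nu>. is_Sigma01_TR \<nu> \<and> range \<nu> \<subseteq> \<A>}"

definition preorder_equiv :: "'a set \<Rightarrow> ('a \<Rightarrow> 'a \<Rightarrow> bool) \<Rightarrow> ('a \<times> 'a) set" where
  "preorder_equiv P le = {(x, y). x \<in> P \<and> y \<in> P \<and> le x y \<and> le y x}"

definition quotient_carrier :: "'a set \<Rightarrow> ('a \<Rightarrow> 'a \<Rightarrow> bool) \<Rightarrow> 'a set set" where
  "quotient_carrier P le = P // preorder_equiv P le"

definition quotient_le :: "('a \<Rightarrow> 'a \<Rightarrow> bool) \<Rightarrow> 'a set \<Rightarrow> 'a set \<Rightarrow> bool" where
  "quotient_le le X Y \<longleftrightarrow> (\<exists>x\<in>X. \<exists>y\<in>Y. le x y)"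

definition Lstar :: "baire set set \<Rightarrow> (baire \<Rightarrow> baire set) set set" where
  "Lstar \<A> = quotient_carrier (TRs_into \<A>) tr_le"

definition posets_isomorphic ::
  "'a set \<Rightarrow> ('a \<Rightarrow> 'a \<Rightarrow> bool) \<Rightarrow> 'b set \<Rightarrow> ('b \<Rightarrow> 'b \<Rightarrow> bool) \<Rightarrow> bool" where
  "posets_isomorphic P leP Q leQ \<longleftrightarrow>
     (\<exists>h. bij_betw h P Q \<and> (\<forall>x\<in>P. \<forall>y\<in>P. leP x y \<longleftrightarrow> leQ (h x) (h y)))"

lemma tr_le_refl: "tr_le \<nu> \<nu>"
  unfolding tr_le_def by (rule exI[of _ id]) (simp add: id_def comp_def)

lemma tr_le_trans:
  assumes "tr_le \<mu> \<nu>" "tr_le \<nu> \<rho>" shows "tr_le \<mu> \<rho>"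
proof -
  obtain f g where f: "continuous_on UNIV f" "\<mu> = \<nu> \<circ> f"
    and g: "continuous_on UNIV g" "\<nu> = \<rho> \<circ> g"
    using assms unfolding tr_le_def by auto
  have "continuous_on UNIV (g \<circ> f)"
    using f(1) g(1) by (meson continuous_on_compose continuous_on_subset subset_UNIV)
  moreover have "\<mu> = \<rho> \<circ> (g \<circ> f)"
    using f(2) g(2) by (simp add: comp_assoc)
  ultimately show ?thesis
    unfolding tr_le_def by blast
qed

lemma equiv_TRs_into: "equiv (TRs_into \<A>) (preorder_equiv (TRs_into \<A>) tr_le)"
  by (rule equivI)
    (auto simp: preorder_equiv_def refl_on_def sym_def trans_def intro: tr_le_refl tr_le_trans)

text \<open>The order on classes does not depend on the representatives.\<close>

lemma quotient_le_class_iff: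
  assumes "\<mu> \<in> TRs_into \<A>" "\<nu> \<in> TRs_into \<A>"
  shows "quotient_le tr_le (preorder_equiv (TRs_into \<A>) tr_le `` {\<mu>})
           (preorder_equiv (TRs_into \<A>) tr_le `` {\<nu>}) \<longleftrightarrow> tr_le \<mu> \<nu>"
  using assms tr_le_refl tr_le_trans
  unfolding quotient_le_def preorder_equiv_def by (simp add: Bex_def) blast

end

theory Submission
  imports Defs
begin

text \<open>For finite \<open>\<A>\<close> a TR into \<open>\<A>\<close> is a continuous map from the Baire space to the poset
  \<open>(\<A>, \<subseteq>)\<close> with its topology of upper sets. Hence an isomorphism of posets induces an isomorphism
  of degrees by composition.

  Conversely, the minimal degrees are those of the constant TRs, and a degree lies above the
  constant \<open>p\<close> iff \<open>p\<close> is among its values. So an isomorphism of degrees induces a bijection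
  \<open>h\<close> of the families that respects ranges. Two elements are incomparable iff there is only one
  degree with exactly these two values, so \<open>h\<close> preserves comparability. If \<open>p\<close> is comparable to
  the incomparable \<open>q\<close> and \<open>r\<close>, then for \<open>q, r \<subseteq> p\<close> the disjoint closed sets where \<open>q\<close> and \<open>r\<close> are
  taken can be separated by a clopen set, so each degree with values \<open>p, q, r\<close> is the join of the
  degrees below it that omit \<open>q\<close> or \<open>r\<close>. For \<open>p \<subseteq> q, r\<close> this fails, since a value \<open>p\<close> can be a
  limit of both \<open>q\<close> and \<open>r\<close>. So \<open>h\<close> also preserves the direction of these configurations. The
  direction of all other edges of the comparability graph is determined up to isomorphism.\<close>

section \<open>Orders with the same comparability graph\<close>

text \<open>In a chain, a down-closed \<open>D\<close> and the down-set of \<open>x\<close> are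
  nested, so their cardinalities tell which contains the other. Later \<open>D\<close> consists of
  the members of a class below an outside element; membership there then depends on rank
  alone.\<close>

lemma chain_rank_le:
  fixes f :: "'c \<Rightarrow> 'a::order"
  assumes fin: "finite S" and chain: "\<And>x y. x \<in> S \<Longrightarrow> y \<in> S \<Longrightarrow> f x \<le> f y \<or> f y \<le> f x"
    and D: "D \<subseteq> S" "\<And>z w. z \<in> D \<Longrightarrow> w \<in> S \<Longrightarrow> f w \<le> f z \<Longrightarrow> w \<in> D"
    and x: "x \<in> S"
  shows "x \<in> D \<longleftrightarrow> card {z\<in>S. f z \<le> f x} \<le> card D"
proof
  assume "x \<in> D"
  then have "{z\<in>S. f z \<le> f x} \<subseteq> D" using D(2) by blast
  then show "card {z\<in>S. f z \<le> f x} \<le> card D"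
    using D(1) fin by (meson card_mono finite_subset)
next
  assume le: "card {z\<in>S. f z \<le> f x} \<le> card D"
  show "x \<in> D"
  proof (rule ccontr)
    assume "x \<notin> D"
    then have "D \<subset> {z\<in>S. f z \<le> f x}" using D chain x by blast
    then show False using le fin psubset_card_mono[of "{z\<in>S. f z \<le> f x}" D] by simp
  qed
qed

lemma chain_rank_mono:
  fixes f :: "'c \<Rightarrow> 'a::order"
  assumes "finite S" "\<And>x y. x \<in> S \<Longrightarrow> y \<in> S \<Longrightarrow> f x \<le> f y \<or> f y \<le> f x"
    and "x \<in> S" "y \<in> S"
  shows "f x \<le> f y \<longleftrightarrow> card {z\<in>S. f z \<le> f x} \<le> card {z\<in>S. f z \<le> f y}"
  using chain_rank_le[of S f "{z\<in>S. f z \<le> f y}" x] assms by (auto intro: order_trans)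

text \<open>Ranks are distinct and lie in \<open>{1..card S}\<close>, so they exhaust this set by
  counting. Two linear orders on the same class therefore have the same ranks, which permits
  matching by rank.\<close>

lemma chain_rank_image:
  fixes f :: "'c \<Rightarrow> 'a::order"
  assumes fin: "finite S" and chain: "\<And>x y. x \<in> S \<Longrightarrow> y \<in> S \<Longrightarrow> f x \<le> f y \<or> f y \<le> f x"
    and inj: "inj_on f S"
  shows "(\<lambda>x. card {z\<in>S. f z \<le> f x}) ` S = {1..card S}"
proof (rule card_subset_eq)
  let ?r = "\<lambda>x. card {z\<in>S. f z \<le> f x}"
  have "?r x \<ge> 1 \<and> ?r x \<le> card S" if "x \<in> S" for x
  proof
    have "{z\<in>S. f z \<le> f x} \<noteq> {}" using that by auto
    then show "?r x \<ge> 1" using fin by (simp add: Suc_le_eq card_gt_0_iff)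
    show "?r x \<le> card S" using fin by (auto intro: card_mono)
  qed
  then show "?r ` S \<subseteq> {1..card S}" by auto
  have "inj_on ?r S"
  proof (rule inj_onI)
    fix x y assume "x \<in> S" "y \<in> S" "?r x = ?r y"
    then have "f x \<le> f y" "f y \<le> f x"
      using chain_rank_mono[of S f x y] chain_rank_mono[of S f y x] fin chain by simp_all
    then show "x = y" using inj \<open>x \<in> S\<close> \<open>y \<in> S\<close> by (simp add: inj_on_eq_iff)
  qed
  then show "card (?r ` S) = card {1..card S}" by (simp add: card_image)
qed simp

text \<open>Elements with the same closed neighbourhood in the comparability graph form chains. Outside
  these twin classes the two orders agree, because two comparable non-twins span an induced path
  with a third element; inside a class any two linear orders can be matched by rank.\<close>

lemma same_comparability_isomorphic:
  fixes u :: "'c \<Rightarrow> 'a::order" and v :: "'c \<Rightarrow> 'b::order"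
  assumes fin: "finite P" and inj_u: "inj_on u P" and inj_v: "inj_on v P"
    and comparable: "\<And>x y. x \<in> P \<Longrightarrow> y \<in> P \<Longrightarrow>
      u x \<le> u y \<or> u y \<le> u x \<longleftrightarrow> v x \<le> v y \<or> v y \<le> v x"
    and fork: "\<And>p q r. \<lbrakk>p \<in> P; q \<in> P; r \<in> P; \<not> u q \<le> u r; \<not> u r \<le> u q;
      u p \<le> u q; u p \<le> u r\<rbrakk> \<Longrightarrow> v p \<le> v q"
    and cofork: "\<And>p q r. \<lbrakk>p \<in> P; q \<in> P; r \<in> P; \<not> u q \<le> u r; \<not> u r \<le> u q;
      u q \<le> u p; u r \<le> u p\<rbrakk> \<Longrightarrow> v q \<le> v p"
  shows "\<exists>g. bij_betw g P P \<and> (\<forall>x\<in>P. \<forall>y\<in>P. u x \<le> u y \<longleftrightarrow> v (g x) \<le> v (g y))"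
proof -
  define cmp where "cmp x y \<longleftrightarrow> u x \<le> u y \<or> u y \<le> u x" for x y
  \<comment> \<open>The class of twins of \<open>x\<close>: the elements comparable to exactly the
    same elements of \<open>P\<close>. The numbers \<open>r\<close> and \<open>r'\<close> are the
    ranks within this class for \<open>u\<close> and \<open>v\<close>.\<close>
  define C where "C x = {y\<in>P. \<forall>z\<in>P. cmp z x \<longleftrightarrow> cmp z y}" for x
  define r where "r x = card {z\<in>C x. u z \<le> u x}" for x
  define r' where "r' x = card {z\<in>C x. v z \<le> v x}" for x
  have cmp_v: "cmp x y \<longleftrightarrow> v x \<le> v y \<or> v y \<le> v x" if "x \<in> P" "y \<in> P" for x y
    using comparable that unfolding cmp_def by simp
  have cmp_sym: "cmp x y \<longleftrightarrow> cmp y x" for x y unfolding cmp_def by auto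
  have C_P: "C x \<subseteq> P" for x unfolding C_def by auto
  have C_self: "x \<in> C x" if "x \<in> P" for x using that unfolding C_def by auto
  have C_eq: "C x = C y" if "y \<in> C x" for x y using that unfolding C_def by auto
  have fin_C: "finite (C x)" for x using fin C_P finite_subset by blast
  have C_chain: "cmp y z" if "y \<in> C x" "z \<in> C x" for x y z
    using that unfolding C_def by (metis (mono_tags, lifting) cmp_def mem_Collect_eq order_refl)
  have u_chain: "u y \<le> u z \<or> u z \<le> u y" if "y \<in> C x" "z \<in> C x" for x y z
    using C_chain[OF that] unfolding cmp_def .
  have v_chain: "v y \<le> v z \<or> v z \<le> v y" if "y \<in> C x" "z \<in> C x" for x y z
    using C_chain[OF that] cmp_v that C_P by blast
  \<comment> \<open>A non-twin \<open>y\<close> of \<open>x\<close> comes with some \<open>z\<close>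
    comparable to exactly one of the two. If it is \<open>x\<close>, then
    \<open>u z \<le> u x\<close> would give \<open>u z \<le> u y\<close>, so \<open>x\<close> lies
    below the incomparable \<open>y\<close> and \<open>z\<close>. If it is \<open>y\<close>, then
    dually \<open>y\<close> lies above the incomparable \<open>x\<close> and
    \<open>z\<close>.\<close>
  have mono: "v x \<le> v y" if xy: "x \<in> P" "y \<in> P" "u x \<le> u y" "y \<notin> C x" for x y
  proof -
    obtain z where z: "z \<in> P" "cmp z x \<noteq> cmp z y"
      using xy unfolding C_def by blast
    show ?thesis
    proof (cases "cmp z x")
      case True
      then show ?thesis using z fork[of x y z] xy unfolding cmp_def by (meson order_trans)
    next
      case False
      then show ?thesis using z cofork[of y x z] xy unfolding cmp_def by (meson order_trans)
    qed
  qed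
  have agree: "u x \<le> u y \<longleftrightarrow> v x \<le> v y" if xy: "x \<in> P" "y \<in> P" "y \<notin> C x" for x y
  proof
    show "v x \<le> v y" if "u x \<le> u y" using mono xy that by blast
    assume vle: "v x \<le> v y"
    show "u x \<le> u y"
    proof (rule ccontr)
      assume "\<not> u x \<le> u y"
      then have "u y \<le> u x" using comparable[of x y] xy vle by blast
      moreover have "x \<notin> C y" using C_eq C_self xy by metis
      ultimately have "v y \<le> v x" using mono xy by blast
      then have "x = y" using vle inj_v xy by (simp add: inj_on_eq_iff)
      then show False using xy C_self by blast
    qed
  qed
  have ex: "\<exists>y. y \<in> C x \<and> r' y = r x" if "x \<in> P" for x
  proof -
    have "r x \<in> {1..card (C x)}"
      using chain_rank_image[where S = "C x" and f = u, OF fin_C u_chain[of _ x] inj_on_subset[OF inj_u C_P]]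
        C_self[OF that]
      unfolding r_def by blast
    then have "r x \<in> (\<lambda>y. card {z\<in>C x. v z \<le> v y}) ` C x"
      using chain_rank_image[where S = "C x" and f = v, OF fin_C v_chain[of _ x] inj_on_subset[OF inj_v C_P]]
      by simp
    then obtain y where y: "y \<in> C x" "r x = card {z\<in>C x. v z \<le> v y}" by blast
    then have "r' y = r x" unfolding r'_def using C_eq[of y x] by simp
    then show ?thesis using y by blast
  qed
  \<comment> \<open>The element whose \<open>v\<close>-rank in the class equals the
    \<open>u\<close>-rank of \<open>x\<close>; it exists since both orders realise the same
    ranks.\<close>
  define g where "g x = (SOME y. y \<in> C x \<and> r' y = r x)" for x
  have g: "g x \<in> C x" "r' (g x) = r x" if "x \<in> P" for x
    using someI_ex[OF ex[OF that]] unfolding g_def by auto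
  have gP: "g x \<in> P" if "x \<in> P" for x using g that C_P by blast
  have Cg: "C (g x) = C x" if "x \<in> P" for x using g that C_eq by blast
  have in_class: "u x \<le> u y \<longleftrightarrow> r x \<le> r y" "v x \<le> v y \<longleftrightarrow> r' x \<le> r' y"
    if "x \<in> P" "y \<in> C x" for x y
    using chain_rank_mono[where S = "C x" and f = u and x = x and y = y, OF fin_C u_chain[of _ x]]
      chain_rank_mono[where S = "C x" and f = v and x = x and y = y, OF fin_C v_chain[of _ x]]
      C_self that C_eq[of y x]
    unfolding r_def r'_def by auto
  \<comment> \<open>For \<open>y\<close> outside the class, the members below \<open>y\<close> form
    the same set for \<open>u\<close> and for \<open>v\<close>. It is an initial segment of both
    chains, so membership is decided by rank, and \<open>g\<close> turns \<open>u\<close>-rank into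
    \<open>v\<close>-rank.\<close>
  have cross: "u x \<le> u y \<longleftrightarrow> v (g x) \<le> v y" if xy: "x \<in> P" "y \<in> P" "y \<notin> C x" for x y
  proof -
    let ?D = "{z\<in>C x. u z \<le> u y}" and ?D' = "{z\<in>C x. v z \<le> v y}"
    have D_eq: "?D = ?D'" using agree xy C_P C_eq by blast
    have "x \<in> ?D \<longleftrightarrow> r x \<le> card ?D"
      unfolding r_def by (rule chain_rank_le[OF fin_C u_chain[of _ x]]) (use C_self xy in \<open>auto intro: order_trans\<close>)
    moreover have "g x \<in> ?D' \<longleftrightarrow> r' (g x) \<le> card ?D'"
      unfolding r'_def Cg[OF xy(1)]
      by (rule chain_rank_le[OF fin_C v_chain[of _ x]]) (use g xy in \<open>auto intro: order_trans\<close>)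
    ultimately have "x \<in> ?D \<longleftrightarrow> g x \<in> ?D'" unfolding D_eq g(2)[OF xy(1)] by argo
    then show ?thesis using g[OF xy(1)] C_self[OF xy(1)] by simp
  qed
  have "inj_on g P"
  proof (rule inj_onI)
    fix x y assume xy: "x \<in> P" "y \<in> P" "g x = g y"
    then have "C x = C y" "r x = r y" using Cg g by metis+
    moreover have "y \<in> C x" "x \<in> C y" using C_self xy \<open>C x = C y\<close> by auto
    ultimately have "u x \<le> u y" "u y \<le> u x" using in_class(1) xy by simp_all
    then show "x = y" using inj_u xy by (simp add: inj_on_eq_iff)
  qed
  moreover have "g ` P \<subseteq> P" using gP by blast
  ultimately have bij: "bij_betw g P P" using fin by (simp add: bij_betw_def endo_inj_surj)
  have iso: "u x \<le> u y \<longleftrightarrow> v (g x) \<le> v (g y)" if xy: "x \<in> P" "y \<in> P" for x y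
  proof (cases "y \<in> C x")
    case True
    then have "g y \<in> C (g x)" using g Cg C_eq xy by metis
    then show ?thesis using in_class True xy gP g by simp
  next
    case False
    have notin: "x \<notin> C y" "y \<notin> C (g x)" "g x \<notin> C y" "g y \<notin> C (g x)" "g x \<noteq> y" "g x \<noteq> g y"
      using False C_eq C_self Cg g xy by (metis, metis, metis, metis, metis, metis)
    have same: "cmp x y \<longleftrightarrow> cmp (g x) y" "cmp (g x) y \<longleftrightarrow> cmp (g x) (g y)"
      using g[OF xy(1)] g[OF xy(2)] gP xy unfolding C_def by (auto simp: cmp_sym)
    \<comment> \<open>The two arguments are moved one at a time. Moving \<open>y\<close> by
      \<open>cross\<close> controls only the reversed inequality; comparability is the same before
      and after, and antisymmetry for distinct elements then settles the inequality wanted.\<close>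
    have 1: "u x \<le> u y \<longleftrightarrow> u (g x) \<le> u y"
      using cross[OF xy False] agree[OF gP[OF xy(1)] xy(2) notin(2)] by simp
    have 2: "u y \<le> u (g x) \<longleftrightarrow> v (g y) \<le> v (g x)"
      using cross[OF xy(2) gP[OF xy(1)] notin(3)] .
    have "u (g x) \<noteq> u y" "v (g x) \<noteq> v (g y)"
      using notin inj_u inj_v xy gP by (auto simp: inj_on_eq_iff)
    then show ?thesis using 1 2 same cmp_v[of "g x" "g y"] gP xy unfolding cmp_def
      by (metis order_antisym)
  qed
  show ?thesis by (intro exI[of _ g] conjI ballI bij iso)
qed

section \<open>Isomorphisms of quotients of preorders\<close>

lemma preorder_equiv_class_iff:
  assumes refl: "\<And>x. le x x" and trans: "\<And>x y z. le x y \<Longrightarrow> le y z \<Longrightarrow> le x z"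
    and xy: "x \<in> P" "y \<in> P"
  shows "quotient_le le (preorder_equiv P le `` {x}) (preorder_equiv P le `` {y}) \<longleftrightarrow> le x y"
    and "preorder_equiv P le `` {x} = preorder_equiv P le `` {y} \<longleftrightarrow> le x y \<and> le y x"
proof -
  let ?c = "\<lambda>x. preorder_equiv P le `` {x}"
  have mem: "z \<in> ?c x \<longleftrightarrow> z \<in> P \<and> le x z \<and> le z x" if "x \<in> P" for x z
    using that unfolding preorder_equiv_def by auto
  show "quotient_le le (?c x) (?c y) \<longleftrightarrow> le x y"
  proof
    assume "quotient_le le (?c x) (?c y)"
    then obtain a b where "le x a" "le a b" "le b y"
      unfolding quotient_le_def using mem xy by blast
    then show "le x y" using trans by blast
  next
    assume "le x y"
    moreover have "x \<in> ?c x" "y \<in> ?c y" using mem refl xy by auto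
    ultimately show "quotient_le le (?c x) (?c y)" unfolding quotient_le_def by blast
  qed
  show "?c x = ?c y \<longleftrightarrow> le x y \<and> le y x"
  proof
    assume "?c x = ?c y"
    then have "y \<in> ?c x" using mem refl xy by auto
    then show "le x y \<and> le y x" using mem xy by blast
  next
    assume "le x y \<and> le y x"
    then have "z \<in> ?c x \<longleftrightarrow> z \<in> ?c y" for z using mem xy trans by metis
    then show "?c x = ?c y" by blast
  qed
qed

text \<open>Choosing representatives lets all later arguments speak of TRs instead of classes.
  Injectivity on classes comes from reflecting the preorder, and surjectivity is required only up to
  equivalence.\<close>

lemma posets_isomorphic_quotient_iff:
  fixes P :: "'a set" and Q :: "'b set"
  assumes refl: "\<And>x. le x x" "\<And>y. le' y y"
    and trans: "\<And>x y z. le x y \<Longrightarrow> le y z \<Longrightarrow> le x z" "\<And>x y z. le' x y \<Longrightarrow> le' y z \<Longrightarrow> le' x z"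
  shows "posets_isomorphic (quotient_carrier P le) (quotient_le le)
      (quotient_carrier Q le') (quotient_le le') \<longleftrightarrow>
    (\<exists>\<phi>. \<phi> ` P \<subseteq> Q \<and> (\<forall>x\<in>P. \<forall>y\<in>P. le x y \<longleftrightarrow> le' (\<phi> x) (\<phi> y)) \<and>
      (\<forall>y\<in>Q. \<exists>x\<in>P. le' y (\<phi> x) \<and> le' (\<phi> x) y))"
    (is "?L \<longleftrightarrow> ?R")
proof -
  define c where "c x = preorder_equiv P le `` {x}" for x
  define d where "d y = preorder_equiv Q le' `` {y}" for y
  have c_iff: "z \<in> c x \<longleftrightarrow> x \<in> P \<and> z \<in> P \<and> le x z \<and> le z x" for x z
    unfolding c_def preorder_equiv_def by auto
  have d_iff: "z \<in> d x \<longleftrightarrow> x \<in> Q \<and> z \<in> Q \<and> le' x z \<and> le' z x" for x z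
    unfolding d_def preorder_equiv_def by auto
  have P_eq: "quotient_carrier P le = c ` P"
    unfolding quotient_carrier_def quotient_def c_def by auto
  have Q_eq: "quotient_carrier Q le' = d ` Q"
    unfolding quotient_carrier_def quotient_def d_def by auto
  have c_le: "quotient_le le (c x) (c y) \<longleftrightarrow> le x y" if "x \<in> P" "y \<in> P" for x y
    unfolding c_def by (rule preorder_equiv_class_iff(1)) (fact refl(1) trans(1) that)+
  have d_le: "quotient_le le' (d x) (d y) \<longleftrightarrow> le' x y" if "x \<in> Q" "y \<in> Q" for x y
    unfolding d_def by (rule preorder_equiv_class_iff(1)) (fact refl(2) trans(2) that)+
  have c_eq: "c x = c y \<longleftrightarrow> le x y \<and> le y x" if "x \<in> P" "y \<in> P" for x y
    unfolding c_def by (rule preorder_equiv_class_iff(2)) (fact refl(1) trans(1) that)+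
  have d_eq: "d x = d y \<longleftrightarrow> le' x y \<and> le' y x" if "x \<in> Q" "y \<in> Q" for x y
    unfolding d_def by (rule preorder_equiv_class_iff(2)) (fact refl(2) trans(2) that)+
  show ?thesis
  proof
    assume ?L
    then obtain H where H: "bij_betw H (c ` P) (d ` Q)"
      and H_le: "\<And>X Y. X \<in> c ` P \<Longrightarrow> Y \<in> c ` P \<Longrightarrow> quotient_le le X Y \<longleftrightarrow> quotient_le le' (H X) (H Y)"
      unfolding posets_isomorphic_def P_eq Q_eq by blast
    have "\<exists>y. y \<in> Q \<and> H (c x) = d y" if "x \<in> P" for x
      using bij_betw_apply[OF H] that by blast
    then obtain \<phi> where \<phi>: "\<phi> x \<in> Q" "H (c x) = d (\<phi> x)" if "x \<in> P" for x by metis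
    have "le x y \<longleftrightarrow> le' (\<phi> x) (\<phi> y)" if "x \<in> P" "y \<in> P" for x y
      using H_le[of "c x" "c y"] \<phi> c_le d_le that by simp
    moreover have "\<exists>x\<in>P. le' y (\<phi> x) \<and> le' (\<phi> x) y" if "y \<in> Q" for y
    proof -
      have "d y \<in> H ` (c ` P)" using H that by (simp add: bij_betw_def)
      then obtain x where "x \<in> P" "d y = H (c x)" by blast
      then show ?thesis using \<phi> d_eq that by metis
    qed
    ultimately show ?R using \<phi>(1) by blast
  next
    assume ?R
    then obtain \<phi> where \<phi>: "\<And>x. x \<in> P \<Longrightarrow> \<phi> x \<in> Q"
      "\<And>x y. x \<in> P \<Longrightarrow> y \<in> P \<Longrightarrow> le x y \<longleftrightarrow> le' (\<phi> x) (\<phi> y)"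
      "\<And>y. y \<in> Q \<Longrightarrow> \<exists>x\<in>P. le' y (\<phi> x) \<and> le' (\<phi> x) y" by blast
    \<comment> \<open>The choice of representative is harmless: \<open>\<phi>\<close> sends
      equivalent elements to equivalent elements.\<close>
    define H where "H X = d (\<phi> (SOME x. x \<in> X))" for X
    have H_c: "H (c x) = d (\<phi> x)" if "x \<in> P" for x
    proof -
      have "(SOME z. z \<in> c x) \<in> c x"
        by (rule someI[of _ x]) (use refl that in \<open>simp add: c_iff\<close>)
      then have "(SOME z. z \<in> c x) \<in> P" "le x (SOME z. z \<in> c x)" "le (SOME z. z \<in> c x) x"
        unfolding c_iff by blast+
      then show ?thesis unfolding H_def using \<phi>(1,2) d_eq that by metis
    qed
    have "inj_on H (c ` P)"
    proof (rule inj_onI)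
      fix X Y assume "X \<in> c ` P" "Y \<in> c ` P" "H X = H Y"
      then obtain x y where xy: "x \<in> P" "y \<in> P" "X = c x" "Y = c y" by blast
      then have "d (\<phi> x) = d (\<phi> y)" using H_c \<open>H X = H Y\<close> by simp
      then have "le x y \<and> le y x" using d_eq \<phi>(1,2) xy by blast
      then show "X = Y" using c_eq xy by blast
    qed
    moreover have "H ` (c ` P) = d ` Q"
    proof
      show "H ` c ` P \<subseteq> d ` Q" using H_c \<phi>(1) by auto
      show "d ` Q \<subseteq> H ` c ` P"
      proof
        fix Y assume "Y \<in> d ` Q"
        then obtain y where y: "y \<in> Q" "Y = d y" by blast
        then obtain x where "x \<in> P" "le' y (\<phi> x)" "le' (\<phi> x) y" using \<phi>(3) by blast
        then have "Y = H (c x)" using H_c d_eq y \<phi>(1) by simp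
        then show "Y \<in> H ` c ` P" using \<open>x \<in> P\<close> by blast
      qed
    qed
    moreover have "quotient_le le X Y \<longleftrightarrow> quotient_le le' (H X) (H Y)"
      if "X \<in> c ` P" "Y \<in> c ` P" for X Y
      using that H_c \<phi> c_le d_le by auto
    ultimately show ?L
      unfolding posets_isomorphic_def P_eq Q_eq bij_betw_def by (intro exI[of _ H] conjI ballI)
  qed
qed

section \<open>The Baire space\<close>

lemma open_cylinder: "open {b :: baire. \<forall>i<n. b i = a i}"
proof -
  have "{b :: baire. \<forall>i<n. b i = a i} = (\<Inter>i<n. (\<lambda>b. b i) -` {a i})" by auto
  moreover have "open ((\<lambda>b :: baire. b i) -` {a i})" for i
    by (rule open_vimage[OF open_discrete continuous_on_product_coordinates])
  ultimately show ?thesis by auto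
qed

text \<open>A basic open set of the product restricts finitely many coordinates, all below some
  \<open>n\<close>; conversely cylinders are open.\<close>

lemma open_baire_iff:
  fixes S :: "baire set"
  shows "open S \<longleftrightarrow> (\<forall>a\<in>S. \<exists>n. \<forall>b. (\<forall>i<n. b i = a i) \<longrightarrow> b \<in> S)"
proof
  assume S: "open S"
  show "\<forall>a\<in>S. \<exists>n. \<forall>b. (\<forall>i<n. b i = a i) \<longrightarrow> b \<in> S"
  proof
    fix a assume "a \<in> S"
    then obtain X where X: "a \<in> Pi\<^sub>E UNIV X" "finite {i. X i \<noteq> UNIV}" "Pi\<^sub>E UNIV X \<subseteq> S"
      using product_topology_open_contains_basis[of "\<lambda>_. euclidean" UNIV S a] S
      unfolding open_fun_def by auto
    obtain n where n: "\<And>i. X i \<noteq> UNIV \<Longrightarrow> i < n"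
      using X(2) unfolding finite_nat_set_iff_bounded by blast
    have "b \<in> S" if "\<forall>i<n. b i = a i" for b
    proof -
      have "a i \<in> X i" for i using X(1) by (auto simp: PiE_iff)
      then have "b i \<in> X i" for i using that n[of i] by (cases "X i = UNIV") auto
      then show ?thesis using X(3) by auto
    qed
    then show "\<exists>n. \<forall>b. (\<forall>i<n. b i = a i) \<longrightarrow> b \<in> S" by blast
  qed
next
  assume cyl: "\<forall>a\<in>S. \<exists>n. \<forall>b. (\<forall>i<n. b i = a i) \<longrightarrow> b \<in> S"
  show "open S"
    unfolding open_subopen[of S]
  proof
    fix a assume "a \<in> S"
    from bspec[OF cyl \<open>a \<in> S\<close>]
    obtain n where n: "\<forall>b. (\<forall>i<n. b i = a i) \<longrightarrow> b \<in> S" ..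
    have "a \<in> {b. \<forall>i<n. b i = a i}" "{b. \<forall>i<n. b i = a i} \<subseteq> S" using n by simp_all blast
    then show "\<exists>T. open T \<and> a \<in> T \<and> T \<subseteq> S" using open_cylinder by blast
  qed
qed

lemma open_baireE:
  fixes S :: "baire set"
  assumes "open S" "a \<in> S"
  obtains n where "\<And>b. (\<forall>i<n. b i = a i) \<Longrightarrow> b \<in> S"
  using open_baire_iff[THEN iffD1, OF assms(1), THEN bspec, OF assms(2)] that by blast

text \<open>Read a point digit by digit until the cylinder of the prefix misses \<open>F\<close> or
  \<open>G\<close>, which must happen as the sets are closed and disjoint. The set \<open>C\<close>
  of points for which \<open>F\<close> is missed at that stage is clopen, because the decision uses
  only the prefix read.\<close>

lemma closed_separation_baire:
  fixes F G :: "baire set"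
  assumes "closed F" "closed G" "F \<inter> G = {}"
  shows "\<exists>C. open C \<and> closed C \<and> G \<subseteq> C \<and> F \<inter> C = {}"
proof -
  define miss where "miss H a n \<longleftrightarrow> (\<forall>b. (\<forall>i<n. b i = a i) \<longrightarrow> b \<notin> H)" for H :: "baire set" and a n
  define m where "m a = (LEAST n. miss F a n \<or> miss G a n)" for a
  define C where "C = {a. miss F a (m a)}"
  have ex: "miss F a (m a) \<or> miss G a (m a)" for a
  proof -
    have miss: "\<exists>n. miss H a n" if "closed H" "a \<notin> H" for H
    proof -
      have "open (- H)" "a \<in> - H" using that by auto
      then obtain n where "\<And>b. (\<forall>i<n. b i = a i) \<Longrightarrow> b \<in> - H" by (rule open_baireE) blast
      then show ?thesis unfolding miss_def by blast
    qed
    have "a \<notin> F \<or> a \<notin> G" using assms(3) by blast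
    then have "\<exists>n. miss F a n \<or> miss G a n" using miss assms(1,2) by blast
    then show ?thesis unfolding m_def by (rule LeastI_ex)
  qed
  have miss_cong: "miss H b n \<longleftrightarrow> miss H a n" if "\<forall>i<n. b i = a i" for H a b n
    using that unfolding miss_def by auto
  \<comment> \<open>The stopping length is itself determined by the prefix of that length: a shorter
    stop for \<open>b\<close> would be one for \<open>a\<close> too.\<close>
  have m_cong: "m b = m a" if eq: "\<forall>i<m a. b i = a i" for a b
  proof -
    have "miss F b (m a) \<or> miss G b (m a)" using ex miss_cong[OF eq] by blast
    moreover have "m a \<le> n" if n: "miss F b n \<or> miss G b n" for n
    proof (rule ccontr)
      assume "\<not> m a \<le> n"
      then have "miss F a n \<or> miss G a n" using n miss_cong[of n b a] eq by auto
      then show False using \<open>\<not> m a \<le> n\<close> unfolding m_def by (simp add: Least_le)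
    qed
    ultimately show ?thesis unfolding m_def[of b] by (rule Least_equality)
  qed
  have C_cong: "b \<in> C \<longleftrightarrow> a \<in> C" if "\<forall>i<m a. b i = a i" for a b
    using m_cong[OF that] miss_cong[OF that] unfolding C_def by simp
  have "open C" "open (- C)"
    unfolding open_baire_iff using C_cong by blast+
  moreover have "F \<inter> C = {}" "G \<subseteq> C"
    using ex unfolding C_def miss_def by blast+
  ultimately show ?thesis unfolding closed_def by blast
qed

lemma continuous_on_if_clopen:
  fixes f g :: "'a::topological_space \<Rightarrow> 'b::topological_space"
  assumes "open C" "closed C" "continuous_on UNIV f" "continuous_on UNIV g"
  shows "continuous_on UNIV (\<lambda>a. if a \<in> C then f a else g a)"
proof -
  have "continuous_on (C \<union> - C) (\<lambda>a. if a \<in> C then f a else g a)"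
    by (rule continuous_on_cases)
      (use assms in \<open>auto intro: continuous_on_subset simp: closed_def\<close>)
  then show ?thesis by (simp add: Compl_partition)
qed

section \<open>Total representations into finite families\<close>

text \<open>Given the universal set, pick for each \<open>V\<close> in the family not containing
  \<open>\<nu> a\<close> a point of \<open>\<nu> a - V\<close>. Containing \<open>\<nu> a\<close>
  then means containing these finitely many points, a finite intersection of open sections.
  Conversely, the universal set is a union of open boxes.\<close>

lemma TRs_into_iff:
  assumes fin: "finite \<A>" and op: "\<forall>U\<in>\<A>. open U"
  shows "\<nu> \<in> TRs_into \<A> \<longleftrightarrow> range \<nu> \<subseteq> \<A> \<and> (\<forall>a. open {b. \<nu> a \<subseteq> \<nu> b})"
proof
  assume "\<nu> \<in> TRs_into \<A>"
  then have ran: "range \<nu> \<subseteq> \<A>" and univ: "open {(a, x). x \<in> \<nu> a}"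
    unfolding TRs_into_def is_Sigma01_TR_def by auto
  have "open {b. \<nu> a \<subseteq> \<nu> b}" for a
  proof -
    have "\<forall>V. \<exists>x. \<not> \<nu> a \<subseteq> V \<longrightarrow> x \<in> \<nu> a - V" by blast
    then obtain w where w: "\<And>V. \<not> \<nu> a \<subseteq> V \<Longrightarrow> w V \<in> \<nu> a - V" by metis
    have section_open: "open {b. x \<in> \<nu> b}" for x
    proof -
      have "open ((\<lambda>b. (b, x)) -` {(a, x). x \<in> \<nu> a})"
        by (rule open_vimage[OF univ]) (intro continuous_intros)
      then show ?thesis by (simp add: vimage_def)
    qed
    have "{b. \<nu> a \<subseteq> \<nu> b} = (\<Inter>V\<in>{V\<in>\<A>. \<not> \<nu> a \<subseteq> V}. {b. w V \<in> \<nu> b})"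
      using w ran by blast
    moreover have "open (\<Inter>V\<in>{V\<in>\<A>. \<not> \<nu> a \<subseteq> V}. {b. w V \<in> \<nu> b})"
      using fin section_open by (intro open_INT) auto
    ultimately show ?thesis by simp
  qed
  then show "range \<nu> \<subseteq> \<A> \<and> (\<forall>a. open {b. \<nu> a \<subseteq> \<nu> b})" using ran by blast
next
  assume *: "range \<nu> \<subseteq> \<A> \<and> (\<forall>a. open {b. \<nu> a \<subseteq> \<nu> b})"
  then have opn: "open (\<nu> a)" for a using op by auto
  have "{(a, x). x \<in> \<nu> a} = (\<Union>a. {b. \<nu> a \<subseteq> \<nu> b} \<times> \<nu> a)" by auto
  moreover have "open (\<Union>a. {b. \<nu> a \<subseteq> \<nu> b} \<times> \<nu> a)" using * opn by (intro open_UN ballI open_Times) auto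
  ultimately show "\<nu> \<in> TRs_into \<A>"
    unfolding TRs_into_def is_Sigma01_TR_def using * opn by simp
qed

lemma tr_leI: "continuous_on UNIV f \<Longrightarrow> (\<And>a. \<mu> a = \<nu> (f a)) \<Longrightarrow> tr_le \<mu> \<nu>"
  unfolding tr_le_def by (intro exI[of _ f]) (auto simp: fun_eq_iff)

lemma tr_leE:
  assumes "tr_le \<mu> \<nu>"
  obtains f where "continuous_on UNIV f" "\<And>a. \<mu> a = \<nu> (f a)"
  using assms unfolding tr_le_def by auto

lemma tr_le_range: "tr_le \<mu> \<nu> \<Longrightarrow> range \<mu> \<subseteq> range \<nu>"
  by (elim tr_leE) auto

lemma tr_le_const: "tr_le (\<lambda>_. p) \<nu> \<longleftrightarrow> p \<in> range \<nu>"
proof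
  show "p \<in> range \<nu>" if "tr_le (\<lambda>_. p) \<nu>" using tr_le_range[OF that] by auto
  assume "p \<in> range \<nu>"
  then obtain a where "p = \<nu> a" by auto
  then show "tr_le (\<lambda>_. p) \<nu>" by (intro tr_leI[of "\<lambda>_. a"]) auto
qed

lemma tr_le_const_right: "tr_le \<nu> (\<lambda>_. p) \<longleftrightarrow> \<nu> = (\<lambda>_. p)"
  unfolding tr_le_def by (auto simp: comp_def intro: continuous_on_const)

section \<open>Joins and forks of TRs\<close>

text \<open>A disjoint sum on two clopen halves, serving as an upper bound of two degrees.\<close>

definition join_TR :: "(baire \<Rightarrow> baire set) \<Rightarrow> (baire \<Rightarrow> baire set) \<Rightarrow> baire \<Rightarrow> baire set" where
  "join_TR \<mu> \<nu> a = (if a 0 = 0 then \<mu> (\<lambda>i. a (Suc i)) else \<nu> (\<lambda>i. a (Suc i)))"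

text \<open>The value \<open>p\<close> is taken only at the zero sequence, as a limit of both
  \<open>q\<close> and \<open>r\<close> (when these differ from \<open>p\<close>). With
  \<open>q = r\<close> it is a two-valued TR whose lower value is not taken on an open set.\<close>

definition fork_TR :: "baire set \<Rightarrow> baire set \<Rightarrow> baire set \<Rightarrow> baire \<Rightarrow> baire set" where
  "fork_TR p q r a = (if \<forall>i. a i = 0 then p else if a (LEAST i. a i \<noteq> 0) = 1 then q else r)"

lemma continuous_on_shift: "continuous_on UNIV (\<lambda>a :: baire. \<lambda>i. a (Suc i))"
  by (rule continuous_on_coordinatewise_then_product) (rule continuous_on_product_coordinates)

lemma continuous_on_case_nat: "continuous_on UNIV (\<lambda>a :: baire. case_nat k a)"
proof (rule continuous_on_coordinatewise_then_product)
  show "continuous_on UNIV (\<lambda>a :: baire. case_nat k a i)" for i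
    by (cases i) (auto intro: continuous_on_product_coordinates)
qed

lemma clopen_first_zero: "open {a :: baire. a 0 = 0}" "open {a :: baire. a 0 \<noteq> 0}"
proof -
  have "open ((\<lambda>a :: baire. a 0) -` S)" for S
    by (rule open_vimage[OF open_discrete continuous_on_product_coordinates])
  from this[of "{0}"] this[of "- {0}"] show "open {a :: baire. a 0 = 0}" "open {a :: baire. a 0 \<noteq> 0}"
    by (simp_all add: vimage_def)
qed

lemma range_join_TR: "range (join_TR \<mu> \<nu>) = range \<mu> \<union> range \<nu>"
proof
  show "range (join_TR \<mu> \<nu>) \<subseteq> range \<mu> \<union> range \<nu>" by (auto simp: join_TR_def)
  have "\<mu> a = join_TR \<mu> \<nu> (case_nat 0 a)" "\<nu> a = join_TR \<mu> \<nu> (case_nat 1 a)" for a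
    by (simp_all add: join_TR_def)
  then show "range \<mu> \<union> range \<nu> \<subseteq> range (join_TR \<mu> \<nu>)" by blast
qed

lemma tr_le_join_TR: "tr_le \<mu> (join_TR \<mu> \<nu>)" "tr_le \<nu> (join_TR \<mu> \<nu>)"
  by (rule tr_leI[OF continuous_on_case_nat[of 0]], simp add: join_TR_def)
    (rule tr_leI[OF continuous_on_case_nat[of 1]], simp add: join_TR_def)

lemma fork_TR_0: "fork_TR p q r (\<lambda>_. 0) = p"
  by (simp add: fork_TR_def)

text \<open>As \<open>n\<close> grows these sequences converge to the zero sequence. The height
  \<open>Suc k\<close> is never zero, and \<open>k = 0\<close> is the height 1 that selects
  \<open>q\<close>.\<close>

lemma fork_TR_spike: "fork_TR p q r (\<lambda>i. if i = n then Suc k else 0) = (if k = 0 then q else r)"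
proof -
  have "(LEAST i. (if i = n then Suc k else 0) \<noteq> 0) = n" by (rule Least_equality) (auto split: if_splits)
  then show ?thesis by (auto simp: fork_TR_def)
qed

lemma range_fork_TR: "range (fork_TR p q r) = {p, q, r}"
proof
  show "range (fork_TR p q r) \<subseteq> {p, q, r}" by (auto simp: fork_TR_def)
  show "{p, q, r} \<subseteq> range (fork_TR p q r)"
    using fork_TR_0[of p q r] fork_TR_spike[of p q r 0 0] fork_TR_spike[of p q r 0 1]
    by (auto intro: range_eqI[OF sym])
qed

text \<open>The point \<open>0\<close> has only one side of the join in its neighbourhood, but all values of the fork.\<close>

lemma fork_TR_le_join_TR:
  assumes "tr_le (fork_TR p q r) (join_TR \<mu> \<nu>)"
  shows "{p, q, r} \<subseteq> range \<mu> \<or> {p, q, r} \<subseteq> range \<nu>"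
proof -
  obtain f where f: "continuous_on UNIV f" "\<And>a. fork_TR p q r a = join_TR \<mu> \<nu> (f a)"
    using assms by (elim tr_leE) blast
  have near: "{p, q, r} \<subseteq> fork_TR p q r ` S" if S: "open S" "(\<lambda>_. 0) \<in> S" for S
  proof -
    obtain n where n: "\<And>b. (\<forall>i<n. b i = 0) \<Longrightarrow> b \<in> S" using open_baireE[OF S] by blast
    have "(if k = 0 then q else r) \<in> fork_TR p q r ` S" for k :: nat
    proof (rule image_eqI)
      show "(if k = 0 then q else r) = fork_TR p q r (\<lambda>i. if i = n then Suc k else 0)"
        by (rule fork_TR_spike[symmetric])
      show "(\<lambda>i. if i = n then Suc k else 0) \<in> S" by (rule n) auto
    qed
    from this[of 0] this[of 1] have "q \<in> fork_TR p q r ` S" "r \<in> fork_TR p q r ` S" by simp_all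
    moreover have "p \<in> fork_TR p q r ` S" using imageI[OF S(2), of "fork_TR p q r"] by (simp add: fork_TR_0)
    ultimately show ?thesis by blast
  qed
  show ?thesis
  \<comment> \<open>The preimage under \<open>f\<close> of the half containing the image of the zero
    sequence is a neighbourhood of that sequence, and only one side of the join is used on
    it.\<close>
  proof (cases "f (\<lambda>_. 0) 0 = 0")
    case True
    then have "{p, q, r} \<subseteq> fork_TR p q r ` (f -` {a. a 0 = 0})"
      by (intro near open_vimage clopen_first_zero f) auto
    also have "\<dots> \<subseteq> range \<mu>" by (auto simp: f join_TR_def)
    finally show ?thesis by simp
  next
    case False
    then have "{p, q, r} \<subseteq> fork_TR p q r ` (f -` {a. a 0 \<noteq> 0})"
      by (intro near open_vimage clopen_first_zero f) auto
    also have "\<dots> \<subseteq> range \<nu>" by (auto simp: f join_TR_def)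
    finally show ?thesis by simp
  qed
qed

section \<open>Degrees over one finite family of open sets\<close>

locale finite_open_family =
  fixes \<A> :: "baire set set"
  assumes fin: "finite \<A>" and opens: "\<forall>U\<in>\<A>. open U"
begin

lemmas TRs_iff = TRs_into_iff[OF fin opens]

lemma TRs_range: "\<nu> \<in> TRs_into \<A> \<Longrightarrow> range \<nu> \<subseteq> \<A>"
  by (simp add: TRs_iff)

lemma TRs_open: "\<nu> \<in> TRs_into \<A> \<Longrightarrow> open {b. p \<subseteq> \<nu> b}" if "p \<in> range \<nu>"
  using that by (auto simp: TRs_iff)

lemma const_TRs: "p \<in> \<A> \<Longrightarrow> (\<lambda>_. p) \<in> TRs_into \<A>"
  by (auto simp: TRs_iff)

lemma TRs_downward: "\<nu> \<in> TRs_into \<A>" if le: "tr_le \<nu> \<mu>" and \<mu>: "\<mu> \<in> TRs_into \<A>"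
proof -
  obtain f where f: "continuous_on UNIV f" "\<And>a. \<nu> a = \<mu> (f a)" using le by (elim tr_leE) blast
  have "open (f -` {b. \<mu> (f a) \<subseteq> \<mu> b})" for a
    by (rule open_vimage[OF _ f(1)]) (use \<mu> TRs_iff in blast)
  then show ?thesis using tr_le_range[OF le] \<mu> unfolding TRs_iff f(2) by (auto simp: vimage_def)
qed

lemma join_TRs:
  assumes "\<mu> \<in> TRs_into \<A>" "\<nu> \<in> TRs_into \<A>"
  shows "join_TR \<mu> \<nu> \<in> TRs_into \<A>"
proof -
  have "open {b. join_TR \<mu> \<nu> a \<subseteq> join_TR \<mu> \<nu> b}" for a
  proof (subst open_subopen, rule ballI)
    fix b assume b: "b \<in> {b. join_TR \<mu> \<nu> a \<subseteq> join_TR \<mu> \<nu> b}"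
    \<comment> \<open>The side on which \<open>b\<close> lies, possibly not that of
      \<open>a\<close>. The neighbourhood is therefore built from the value at \<open>b\<close>,
      which contains the value at \<open>a\<close>.\<close>
    define \<rho> where "\<rho> = (if b 0 = 0 then \<mu> else \<nu>)"
    let ?S = "{c. c 0 = 0 \<longleftrightarrow> b 0 = 0} \<inter> (\<lambda>c i. c (Suc i)) -` {c. \<rho> (\<lambda>i. b (Suc i)) \<subseteq> \<rho> c}"
    have "open {c :: baire. c 0 = 0 \<longleftrightarrow> b 0 = 0}"
      by (cases "b 0 = 0") (use clopen_first_zero in auto)
    moreover have "open {c. \<rho> (\<lambda>i. b (Suc i)) \<subseteq> \<rho> c}"
      using assms unfolding \<rho>_def TRs_iff by auto
    ultimately have "open ?S" by (intro open_Int open_vimage continuous_on_shift)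
    moreover have "b \<in> ?S" "?S \<subseteq> {b. join_TR \<mu> \<nu> a \<subseteq> join_TR \<mu> \<nu> b}"
      using b by (auto simp: join_TR_def \<rho>_def split: if_splits)
    ultimately show "\<exists>T. open T \<and> b \<in> T \<and> T \<subseteq> {b. join_TR \<mu> \<nu> a \<subseteq> join_TR \<mu> \<nu> b}" by blast
  qed
  then show ?thesis using assms unfolding TRs_iff range_join_TR by auto
qed

text \<open>Away from the zero sequence the fork is locally constant. At the zero sequence it takes
  \<open>p\<close>, the least of its values, so being above that value is no constraint
  nearby.\<close>

lemma fork_TRs:
  assumes "p \<in> \<A>" "q \<in> \<A>" "r \<in> \<A>" "p \<subseteq> q" "p \<subseteq> r"
  shows "fork_TR p q r \<in> TRs_into \<A>"
proof -
  have "open {b. fork_TR p q r a \<subseteq> fork_TR p q r b}" for a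
    unfolding open_baire_iff
  proof
    fix b assume b: "b \<in> {b. fork_TR p q r a \<subseteq> fork_TR p q r b}"
    show "\<exists>n. \<forall>c. (\<forall>i<n. c i = b i) \<longrightarrow> c \<in> {b. fork_TR p q r a \<subseteq> fork_TR p q r b}"
    proof (cases "\<forall>i. b i = 0")
      case True
      then have "fork_TR p q r a \<subseteq> p" using b by (simp add: fork_TR_def)
      moreover have "p \<subseteq> fork_TR p q r c" for c using assms by (simp add: fork_TR_def)
      ultimately show ?thesis by blast
    next
      case False
      define n where "n = (LEAST i. b i \<noteq> 0)"
      have ex: "\<exists>i. b i \<noteq> 0" using False by blast
      have n: "b n \<noteq> 0" unfolding n_def by (rule LeastI_ex[OF ex])
      have below: "b i = 0" if "i < n" for i using not_less_Least that unfolding n_def by blast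
      \<comment> \<open>The prefix has length \<open>Suc n\<close> so that it includes the first
        nonzero digit, which decides between \<open>q\<close> and \<open>r\<close>.\<close>
      have same: "fork_TR p q r c = fork_TR p q r b" if c: "\<forall>i<Suc n. c i = b i" for c
      proof -
        have "(LEAST i. c i \<noteq> 0) = n"
        proof (rule Least_equality)
          show "c n \<noteq> 0" using c n by simp
          show "n \<le> i" if "c i \<noteq> 0" for i
            using that below[of i] c by (metis less_SucI not_le)
        qed
        moreover have "c n = b n" using c by simp
        moreover have "\<not> (\<forall>i. c i = 0)" using \<open>c n = b n\<close> n by metis
        ultimately have "fork_TR p q r c = (if b n = 1 then q else r)"
          unfolding fork_TR_def by presburger
        also have "\<dots> = fork_TR p q r b" unfolding fork_TR_def n_def using False by presburger
        finally show ?thesis .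
      qed
      have "c \<in> {b. fork_TR p q r a \<subseteq> fork_TR p q r b}" if "\<forall>i<Suc n. c i = b i" for c
        using b same[OF that] by simp
      then show ?thesis by (intro exI[of _ "Suc n"] allI impI)
    qed
  qed
  then show ?thesis using assms by (simp add: TRs_iff range_fork_TR)
qed

section \<open>Properties of degrees that reveal inclusions\<close>

text \<open>Exchanging \<open>\<mu>\<close> and \<open>\<nu>\<close> gives equivalence. Only ranges
  and \<open>tr_le\<close> occur, so that the notion can be transported along an isomorphism of
  degrees.\<close>

definition two_valued_unique :: "baire set \<Rightarrow> baire set \<Rightarrow> bool" where
  "two_valued_unique p q \<longleftrightarrow> (\<forall>\<mu>\<in>TRs_into \<A>. \<forall>\<nu>\<in>TRs_into \<A>.
     range \<mu> = {p, q} \<longrightarrow> range \<nu> = {p, q} \<longrightarrow> tr_le \<mu> \<nu>)"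

text \<open>If \<open>p \<subseteq> q\<close>, then \<open>fork_TR p q q\<close> and the join of the
  two constants have the same range, but the fork does not reduce to the join. If the values are
  incomparable, each is taken on a clopen set, and a reduction may send each set to a single point
  with the right value.\<close>

lemma two_valued_unique_iff:
  assumes "p \<in> \<A>" "q \<in> \<A>" "p \<noteq> q"
  shows "two_valued_unique p q \<longleftrightarrow> \<not> p \<subseteq> q \<and> \<not> q \<subseteq> p"
proof
  have not_unique: "\<not> two_valued_unique p q" "\<not> two_valued_unique q p"
    if "p \<in> \<A>" "q \<in> \<A>" "p \<noteq> q" "p \<subseteq> q" for p q
  proof -
    have "fork_TR p q q \<in> TRs_into \<A>" "join_TR (\<lambda>_. p) (\<lambda>_. q) \<in> TRs_into \<A>"
      using that fork_TRs join_TRs const_TRs by auto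
    moreover have "range (fork_TR p q q) = {p, q}" "range (join_TR (\<lambda>_. p) (\<lambda>_. q)) = {p, q}"
      by (auto simp: range_fork_TR range_join_TR)
    moreover have "\<not> tr_le (fork_TR p q q) (join_TR (\<lambda>_. p) (\<lambda>_. q))"
      using fork_TR_le_join_TR[of p q q "\<lambda>_. p" "\<lambda>_. q"] that by auto
    ultimately show "\<not> two_valued_unique p q" "\<not> two_valued_unique q p"
      unfolding two_valued_unique_def by (auto simp: insert_commute)
  qed
  show "\<not> p \<subseteq> q \<and> \<not> q \<subseteq> p" if "two_valued_unique p q"
    using that not_unique[of p q] not_unique[of q p] assms by auto
  assume inc: "\<not> p \<subseteq> q \<and> \<not> q \<subseteq> p"
  show "two_valued_unique p q"
    unfolding two_valued_unique_def
  proof (intro ballI impI)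
    fix \<mu> \<nu> :: "baire \<Rightarrow> baire set"
    assume \<mu>: "\<mu> \<in> TRs_into \<A>" "range \<mu> = {p, q}" and \<nu>: "range \<nu> = {p, q}"
    have "p \<in> range \<nu>" "q \<in> range \<nu>" using \<nu> by auto
    then obtain a b where ab: "p = \<nu> a" "q = \<nu> b" by blast
    have vals: "\<mu> c = p \<or> \<mu> c = q" for c using \<mu>(2) by blast
    then have "{c. \<mu> c = p} = {c. p \<subseteq> \<mu> c}" "- {c. \<mu> c = p} = {c. q \<subseteq> \<mu> c}"
      using inc by blast+
    then have "open {c. \<mu> c = p}" "closed {c. \<mu> c = p}"
      unfolding closed_def using TRs_open[OF _ \<mu>(1)] \<mu>(2) by auto
    then have "continuous_on UNIV (\<lambda>c. if c \<in> {c. \<mu> c = p} then a else b)"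
      by (intro continuous_on_if_clopen) auto
    then show "tr_le \<mu> \<nu>"
      by (rule tr_leI[where f = "\<lambda>c. if c \<in> {c. \<mu> c = p} then a else b"]) (use vals ab in auto)
  qed
qed

text \<open>Every degree with range \<open>{p, q, r}\<close> is the least upper bound of the degrees
  below it that omit \<open>q\<close> or \<open>r\<close>: \<open>\<nu>\<close> is an arbitrary
  upper bound of these.\<close>

definition decomposable :: "baire set \<Rightarrow> baire set \<Rightarrow> baire set \<Rightarrow> bool" where
  "decomposable p q r \<longleftrightarrow> (\<forall>\<mu>\<in>TRs_into \<A>. \<forall>\<nu>\<in>TRs_into \<A>. range \<mu> = {p, q, r} \<longrightarrow>
     (\<forall>\<rho>\<in>TRs_into \<A>. tr_le \<rho> \<mu> \<longrightarrow> range \<rho> \<subseteq> {p, q} \<or> range \<rho> \<subseteq> {p, r} \<longrightarrow> tr_le \<rho> \<nu>) \<longrightarrow>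
     tr_le \<mu> \<nu>)"

text \<open>The join of \<open>fork_TR p q q\<close> and \<open>fork_TR p r r\<close> bounds all
  parts of \<open>fork_TR p q r\<close> that omit \<open>q\<close> or \<open>r\<close>, but not the
  fork itself, since neither side of the join has all three values.\<close>

lemma fork_not_decomposable:
  assumes "p \<in> \<A>" "q \<in> \<A>" "r \<in> \<A>" "p \<subseteq> q" "p \<subseteq> r" "\<not> q \<subseteq> r" "\<not> r \<subseteq> q"
  shows "\<not> decomposable p q r"
proof
  assume dec: "decomposable p q r"
  let ?\<nu> = "join_TR (fork_TR p q q) (fork_TR p r r)"
  have ne: "p \<noteq> q" "p \<noteq> r" "q \<noteq> r" using assms by auto
  have parts: "tr_le \<rho> ?\<nu>" if le: "tr_le \<rho> (fork_TR p q r)" and ran: "range \<rho> \<subseteq> {p, q} \<or> range \<rho> \<subseteq> {p, r}" for \<rho>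
  proof -
    obtain f where f: "continuous_on UNIV f" "\<And>a. \<rho> a = fork_TR p q r (f a)"
      using le by (elim tr_leE) blast
    \<comment> \<open>Along \<open>f\<close> the value \<open>r\<close> never occurs, so replacing
      \<open>r\<close> by \<open>q\<close> in the fork changes nothing, and the same
      \<open>f\<close> is a reduction.\<close>
    have q: "\<rho> a = fork_TR p q q (f a)" if "range \<rho> \<subseteq> {p, q}" for a
    proof -
      have "\<rho> a \<in> {p, q}" using that by blast
      then show ?thesis using ne by (auto simp: f fork_TR_def split: if_splits)
    qed
    have r: "\<rho> a = fork_TR p r r (f a)" if "range \<rho> \<subseteq> {p, r}" for a
    proof -
      have "\<rho> a \<in> {p, r}" using that by blast
      then show ?thesis using ne by (auto simp: f fork_TR_def split: if_splits)
    qed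
    show ?thesis
      using ran
    proof
      assume "range \<rho> \<subseteq> {p, q}"
      then have "tr_le \<rho> (fork_TR p q q)"
        by (intro tr_leI[OF f(1), of \<rho> "fork_TR p q q"] q)
      then show ?thesis using tr_le_join_TR(1) by (rule tr_le_trans)
    next
      assume "range \<rho> \<subseteq> {p, r}"
      then have "tr_le \<rho> (fork_TR p r r)"
        by (intro tr_leI[OF f(1), of \<rho> "fork_TR p r r"] r)
      then show ?thesis using tr_le_join_TR(2) by (rule tr_le_trans)
    qed
  qed
  have "fork_TR p q r \<in> TRs_into \<A>" "?\<nu> \<in> TRs_into \<A>"
    using assms fork_TRs join_TRs by auto
  then have "tr_le (fork_TR p q r) ?\<nu>"
    using dec[unfolded decomposable_def, rule_format, of "fork_TR p q r" ?\<nu>] range_fork_TR parts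
    by simp
  then have "{p, q, r} \<subseteq> {p, q} \<or> {p, q, r} \<subseteq> {p, r}"
    using fork_TR_le_join_TR[of p q r "fork_TR p q q" "fork_TR p r r"] by (simp add: range_fork_TR)
  then show False using ne by auto
qed

text \<open>The sets where \<open>q\<close> and \<open>r\<close> are taken are closed, being
  complements of \<open>{a. r \<subseteq> \<mu> a}\<close> and
  \<open>{a. q \<subseteq> \<mu> a}\<close>. A clopen \<open>C\<close> separating them cuts
  \<open>\<mu>\<close> into a part without \<open>q\<close> and a part without \<open>r\<close>;
  both reduce to \<open>\<nu>\<close>, and the reductions glue along \<open>C\<close>.\<close>

lemma cofork_decomposable:
  assumes "q \<subseteq> p" "r \<subseteq> p" "\<not> q \<subseteq> r" "\<not> r \<subseteq> q"
  shows "decomposable p q r"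
  unfolding decomposable_def
proof (intro ballI impI)
  fix \<mu> \<nu> assume \<mu>: "\<mu> \<in> TRs_into \<A>" "range \<mu> = {p, q, r}"
    and parts: "\<forall>\<rho>\<in>TRs_into \<A>. tr_le \<rho> \<mu> \<longrightarrow> range \<rho> \<subseteq> {p, q} \<or> range \<rho> \<subseteq> {p, r} \<longrightarrow> tr_le \<rho> \<nu>"
  have vals: "\<mu> a = p \<or> \<mu> a = q \<or> \<mu> a = r" for a using \<mu>(2) by blast
  have "- {a. \<mu> a = q} = {a. r \<subseteq> \<mu> a}" "- {a. \<mu> a = r} = {a. q \<subseteq> \<mu> a}"
    using assms vals by blast+
  then have cl: "closed {a. \<mu> a = q}" "closed {a. \<mu> a = r}"
    unfolding closed_def using TRs_open[OF _ \<mu>(1)] \<mu>(2) by auto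
  have disj: "{a. \<mu> a = q} \<inter> {a. \<mu> a = r} = {}" using assms by auto
  obtain C where C: "open C" "closed C" "{a. \<mu> a = r} \<subseteq> C" "{a. \<mu> a = q} \<inter> C = {}"
    using closed_separation_baire[OF cl disj] by blast
  have "r \<in> range \<mu>" "q \<in> range \<mu>" using \<mu>(2) by auto
  then obtain c d where cd: "\<mu> c = r" "\<mu> d = q" by blast
  have "c \<in> C" "d \<notin> C" using C cd by auto
  \<comment> \<open>Composing with \<open>f\<close> keeps \<open>\<mu>\<close> on \<open>C\<close>
    and fills the complement with the value \<open>r\<close> from \<open>c\<close>, so that
    \<open>q\<close> disappears. Likewise \<open>g\<close> keeps \<open>\<mu>\<close> off
    \<open>C\<close> and removes \<open>r\<close>.\<close>
  define f where "f a = (if a \<in> C then a else c)" for a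
  define g where "g a = (if a \<in> C then d else a)" for a
  have f: "continuous_on UNIV f" and g: "continuous_on UNIV g"
    unfolding f_def g_def by (intro continuous_on_if_clopen C continuous_intros)+
  have "tr_le (\<lambda>a. \<mu> (f a)) \<mu>" "tr_le (\<lambda>a. \<mu> (g a)) \<mu>"
    using tr_leI[OF f] tr_leI[OF g] by auto
  moreover have "range (\<lambda>a. \<mu> (f a)) \<subseteq> {p, r}" "range (\<lambda>a. \<mu> (g a)) \<subseteq> {p, q}"
  proof -
    have "\<mu> (f a) \<in> {p, r}" for a using C(4) vals[of a] cd(1) by (cases "a \<in> C") (auto simp: f_def)
    then show "range (\<lambda>a. \<mu> (f a)) \<subseteq> {p, r}" by blast
    have "\<mu> (g a) \<in> {p, q}" for a using C(3) vals[of a] cd(2) by (cases "a \<in> C") (auto simp: g_def)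
    then show "range (\<lambda>a. \<mu> (g a)) \<subseteq> {p, q}" by blast
  qed
  moreover have "tr_le \<rho> \<nu>" if "tr_le \<rho> \<mu>" "range \<rho> \<subseteq> {p, q} \<or> range \<rho> \<subseteq> {p, r}" for \<rho>
    using parts[THEN bspec, OF TRs_downward[OF that(1) \<mu>(1)]] that by simp
  ultimately have "tr_le (\<lambda>a. \<mu> (f a)) \<nu>" "tr_le (\<lambda>a. \<mu> (g a)) \<nu>" by simp_all
  then obtain f' g' where f': "continuous_on UNIV f'" "\<And>a. \<mu> (f a) = \<nu> (f' a)"
    and g': "continuous_on UNIV g'" "\<And>a. \<mu> (g a) = \<nu> (g' a)"
    by (elim tr_leE) blast
  show "tr_le \<mu> \<nu>"
  proof (rule tr_leI[where f = "\<lambda>a. if a \<in> C then f' a else g' a"])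
    show "continuous_on UNIV (\<lambda>a. if a \<in> C then f' a else g' a)"
      by (intro continuous_on_if_clopen C f' g')
    show "\<mu> a = \<nu> (if a \<in> C then f' a else g' a)" for a
      using f'(2)[of a] g'(2)[of a] by (auto simp: f_def g_def)
  qed
qed

end

section \<open>Recovering the family from its degrees\<close>

locale degree_isomorphism =
  A: finite_open_family \<A> + B: finite_open_family \<B> for \<A> \<B> :: "baire set set" +
  fixes \<phi> :: "(baire \<Rightarrow> baire set) \<Rightarrow> baire \<Rightarrow> baire set"
  assumes maps: "\<nu> \<in> TRs_into \<A> \<Longrightarrow> \<phi> \<nu> \<in> TRs_into \<B>"
    and le_iff: "\<mu> \<in> TRs_into \<A> \<Longrightarrow> \<nu> \<in> TRs_into \<A> \<Longrightarrow> tr_le (\<phi> \<mu>) (\<phi> \<nu>) \<longleftrightarrow> tr_le \<mu> \<nu>"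
    and onto: "\<rho> \<in> TRs_into \<B> \<Longrightarrow> \<exists>\<nu>\<in>TRs_into \<A>. tr_le \<rho> (\<phi> \<nu>) \<and> tr_le (\<phi> \<nu>) \<rho>"
begin

text \<open>The point of evaluation is arbitrary, since \<open>\<phi>\<close> of a constant is shown
  to be constant.\<close>

definition h :: "baire set \<Rightarrow> baire set" where
  "h p = \<phi> (\<lambda>_. p) (\<lambda>_. 0)"

text \<open>The constant \<open>h p\<close> lies below the image of the constant \<open>p\<close>
  and is equivalent to some \<open>\<phi> \<nu>\<close>. Then \<open>\<nu>\<close> lies below the
  constant \<open>p\<close>, hence equals it, and so the image lies below the constant
  \<open>h p\<close>.\<close>

lemma \<phi>_const:
  assumes p: "p \<in> \<A>"
  shows "\<phi> (\<lambda>_. p) = (\<lambda>_. h p)" and "h p \<in> \<B>"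
proof -
  have B: "\<phi> (\<lambda>_. p) \<in> TRs_into \<B>" using maps A.const_TRs p by blast
  show "h p \<in> \<B>" using B.TRs_range[OF B] unfolding h_def by blast
  then obtain \<nu> where \<nu>: "\<nu> \<in> TRs_into \<A>" "tr_le (\<lambda>_. h p) (\<phi> \<nu>)" "tr_le (\<phi> \<nu>) (\<lambda>_. h p)"
    using onto B.const_TRs by blast
  have "tr_le (\<lambda>_. h p) (\<phi> (\<lambda>_. p))" unfolding tr_le_const h_def by blast
  then have "tr_le (\<phi> \<nu>) (\<phi> (\<lambda>_. p))" using \<nu> tr_le_trans by blast
  then have "\<nu> = (\<lambda>_. p)" using le_iff \<nu> A.const_TRs p tr_le_const_right by blast
  then show "\<phi> (\<lambda>_. p) = (\<lambda>_. h p)" using \<nu> tr_le_const_right by blast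
qed

lemma bij_h: "bij_betw h \<A> \<B>"
proof -
  have inj: "inj_on h \<A>"
  proof (rule inj_onI)
    fix p q assume pq: "p \<in> \<A>" "q \<in> \<A>" "h p = h q"
    then have "tr_le (\<lambda>_. p) (\<lambda>_. q)"
      using le_iff[of "\<lambda>_. p" "\<lambda>_. q"] \<phi>_const A.const_TRs tr_le_refl by auto
    then show "p = q" by (auto simp: tr_le_const)
  qed
  have "q \<in> h ` \<A>" if q: "q \<in> \<B>" for q
  proof -
    obtain \<nu> where \<nu>: "\<nu> \<in> TRs_into \<A>" "tr_le (\<phi> \<nu>) (\<lambda>_. q)"
      using onto B.const_TRs q by blast
    \<comment> \<open>Any value of \<open>\<nu>\<close> works: its constant lies below
      \<open>\<nu>\<close>, so the constant \<open>h p\<close> lies below the constant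
      \<open>q\<close>, which forces \<open>h p = q\<close>.\<close>
    obtain p where p: "p \<in> range \<nu>" by blast
    then have "p \<in> \<A>" using A.TRs_range \<nu> by blast
    then have "tr_le (\<phi> (\<lambda>_. p)) (\<phi> \<nu>)" using p \<nu> le_iff A.const_TRs tr_le_const by blast
    then have "tr_le (\<lambda>_. h p) (\<lambda>_. q)" using \<nu> tr_le_trans \<phi>_const \<open>p \<in> \<A>\<close> by metis
    then show ?thesis using \<open>p \<in> \<A>\<close> by (auto simp: tr_le_const)
  qed
  then have "h ` \<A> = \<B>" using \<phi>_const(2) by auto
  then show ?thesis using inj by (simp add: bij_betw_def)
qed

text \<open>By \<open>tr_le_const\<close> the values of a TR are the constants below it, and
  \<open>\<phi>\<close> preserves and reflects this relation.\<close>

lemma range_\<phi>: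
  assumes \<nu>: "\<nu> \<in> TRs_into \<A>"
  shows "range (\<phi> \<nu>) = h ` range \<nu>"
proof -
  have mem: "h p \<in> range (\<phi> \<nu>) \<longleftrightarrow> p \<in> range \<nu>" if "p \<in> \<A>" for p
    using le_iff[OF A.const_TRs[OF that] \<nu>] \<phi>_const[OF that] tr_le_const by simp
  have sub: "range (\<phi> \<nu>) \<subseteq> h ` \<A>"
    using bij_h B.TRs_range[OF maps[OF \<nu>]] by (simp add: bij_betw_def)
  show ?thesis
  proof (intro equalityI subsetI)
    fix x assume x: "x \<in> range (\<phi> \<nu>)"
    then obtain p where "p \<in> \<A>" "x = h p" using sub by auto
    then show "x \<in> h ` range \<nu>" using mem x by auto
  next
    fix x assume "x \<in> h ` range \<nu>"
    then obtain p where "p \<in> range \<nu>" "x = h p" by auto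
    then show "x \<in> range (\<phi> \<nu>)" using mem A.TRs_range[OF \<nu>] by auto
  qed
qed

lemma range_\<phi>_iff:
  assumes "\<nu> \<in> TRs_into \<A>" "S \<subseteq> \<A>"
  shows "range (\<phi> \<nu>) \<subseteq> h ` S \<longleftrightarrow> range \<nu> \<subseteq> S" and "range (\<phi> \<nu>) = h ` S \<longleftrightarrow> range \<nu> = S"
proof -
  have inj: "inj_on h \<A>" using bij_h by (simp add: bij_betw_def)
  show "range (\<phi> \<nu>) \<subseteq> h ` S \<longleftrightarrow> range \<nu> \<subseteq> S"
    using inj_on_image_mem_iff[OF inj _ assms(2)] A.TRs_range[OF assms(1)]
    by (auto simp: range_\<phi>[OF assms(1)] image_subset_iff)
  show "range (\<phi> \<nu>) = h ` S \<longleftrightarrow> range \<nu> = S"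
    using inj_on_image_eq_iff[OF inj A.TRs_range] assms by (simp add: range_\<phi>)
qed

text \<open>Since \<open>\<phi>\<close> reaches TRs into \<open>\<B>\<close> only up to equivalence,
  a quantifier can be moved only for properties invariant under equivalence.\<close>

lemma ball_TRs_into:
  assumes "\<And>\<rho> \<rho>'. tr_le \<rho> \<rho>' \<Longrightarrow> tr_le \<rho>' \<rho> \<Longrightarrow> Q \<rho> \<longleftrightarrow> Q \<rho>'"
  shows "(\<forall>\<rho>\<in>TRs_into \<B>. Q \<rho>) \<longleftrightarrow> (\<forall>\<nu>\<in>TRs_into \<A>. Q (\<phi> \<nu>))"
proof
  show "\<forall>\<nu>\<in>TRs_into \<A>. Q (\<phi> \<nu>)" if "\<forall>\<rho>\<in>TRs_into \<B>. Q \<rho>"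
    using that maps by simp
  show "\<forall>\<rho>\<in>TRs_into \<B>. Q \<rho>" if Q: "\<forall>\<nu>\<in>TRs_into \<A>. Q (\<phi> \<nu>)"
  proof
    fix \<rho> assume "\<rho> \<in> TRs_into \<B>"
    then obtain \<nu> where \<nu>: "\<nu> \<in> TRs_into \<A>" "tr_le \<rho> (\<phi> \<nu>)" "tr_le (\<phi> \<nu>) \<rho>"
      using onto by blast
    show "Q \<rho>" using assms[OF \<nu>(2,3)] Q \<nu>(1) by simp
  qed
qed

lemma ball_ball_TRs_into:
  assumes "\<And>\<rho> \<rho>' \<sigma>. tr_le \<rho> \<rho>' \<Longrightarrow> tr_le \<rho>' \<rho> \<Longrightarrow> Q \<rho> \<sigma> \<longleftrightarrow> Q \<rho>' \<sigma>"
    and "\<And>\<rho> \<rho>' \<sigma>. tr_le \<rho> \<rho>' \<Longrightarrow> tr_le \<rho>' \<rho> \<Longrightarrow> Q \<sigma> \<rho> \<longleftrightarrow> Q \<sigma> \<rho>'"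
  shows "(\<forall>\<mu>\<in>TRs_into \<B>. \<forall>\<nu>\<in>TRs_into \<B>. Q \<mu> \<nu>) \<longleftrightarrow>
    (\<forall>\<mu>\<in>TRs_into \<A>. \<forall>\<nu>\<in>TRs_into \<A>. Q (\<phi> \<mu>) (\<phi> \<nu>))"
proof -
  have 1: "(\<forall>\<mu>\<in>TRs_into \<B>. \<forall>\<nu>\<in>TRs_into \<B>. Q \<mu> \<nu>) \<longleftrightarrow> (\<forall>\<mu>\<in>TRs_into \<A>. \<forall>\<nu>\<in>TRs_into \<B>. Q (\<phi> \<mu>) \<nu>)"
    by (rule ball_TRs_into, rule ball_cong[OF refl], erule (1) assms(1))
  have 2: "(\<forall>\<nu>\<in>TRs_into \<B>. Q \<mu> \<nu>) \<longleftrightarrow> (\<forall>\<nu>\<in>TRs_into \<A>. Q \<mu> (\<phi> \<nu>))" for \<mu>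
    by (rule ball_TRs_into, erule (1) assms(2))
  show ?thesis by (rule trans[OF 1], rule ball_cong[OF refl], rule 2)
qed

lemma tr_le_cong:
  assumes "tr_le \<rho> \<rho>'" "tr_le \<rho>' \<rho>"
  shows "range \<rho> = range \<rho>'" "tr_le \<rho> \<sigma> \<longleftrightarrow> tr_le \<rho>' \<sigma>" "tr_le \<sigma> \<rho> \<longleftrightarrow> tr_le \<sigma> \<rho>'"
proof -
  show "range \<rho> = range \<rho>'" using assms[THEN tr_le_range] by (rule equalityI)
  show "tr_le \<rho> \<sigma> \<longleftrightarrow> tr_le \<rho>' \<sigma>" using tr_le_trans[OF assms(1)] tr_le_trans[OF assms(2)] by blast
  show "tr_le \<sigma> \<rho> \<longleftrightarrow> tr_le \<sigma> \<rho>'"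
    using tr_le_trans[OF _ assms(1)] tr_le_trans[OF _ assms(2)] by blast
qed

lemma two_valued_unique_h:
  assumes "p \<in> \<A>" "q \<in> \<A>"
  shows "B.two_valued_unique (h p) (h q) \<longleftrightarrow> A.two_valued_unique p q"
proof -
  have "range (\<phi> \<nu>) = {h p, h q} \<longleftrightarrow> range \<nu> = {p, q}" if "\<nu> \<in> TRs_into \<A>" for \<nu>
    using range_\<phi>_iff(2)[OF that, of "{p, q}"] assms by simp
  moreover have "B.two_valued_unique (h p) (h q) \<longleftrightarrow>
    (\<forall>\<mu>\<in>TRs_into \<A>. \<forall>\<nu>\<in>TRs_into \<A>. range (\<phi> \<mu>) = {h p, h q} \<longrightarrow> range (\<phi> \<nu>) = {h p, h q} \<longrightarrow>
      tr_le (\<phi> \<mu>) (\<phi> \<nu>))"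
  proof -
    define T where "T \<mu> \<nu> \<longleftrightarrow> (range \<mu> = {h p, h q} \<longrightarrow> range \<nu> = {h p, h q} \<longrightarrow> tr_le \<mu> \<nu>)" for \<mu> \<nu>
    have T_cong: "T \<mu> \<sigma> \<longleftrightarrow> T \<mu>' \<sigma>" "T \<sigma> \<mu> \<longleftrightarrow> T \<sigma> \<mu>'" if "tr_le \<mu> \<mu>'" "tr_le \<mu>' \<mu>" for \<mu> \<mu>' \<sigma>
      unfolding T_def tr_le_cong[OF that] by (rule refl)+
    have "(\<forall>\<mu>\<in>TRs_into \<B>. \<forall>\<nu>\<in>TRs_into \<B>. T \<mu> \<nu>) \<longleftrightarrow>
        (\<forall>\<mu>\<in>TRs_into \<A>. \<forall>\<nu>\<in>TRs_into \<A>. T (\<phi> \<mu>) (\<phi> \<nu>))"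
      by (rule ball_ball_TRs_into) (erule (1) T_cong(1), erule (1) T_cong(2))
    then show ?thesis unfolding B.two_valued_unique_def T_def .
  qed
  ultimately show ?thesis unfolding A.two_valued_unique_def using le_iff by simp
qed

lemma decomposable_h:
  assumes "p \<in> \<A>" "q \<in> \<A>" "r \<in> \<A>"
  shows "B.decomposable (h p) (h q) (h r) \<longleftrightarrow> A.decomposable p q r"
proof -
  have "range (\<phi> \<nu>) = {h p, h q, h r} \<longleftrightarrow> range \<nu> = {p, q, r}"
    "range (\<phi> \<nu>) \<subseteq> {h p, h q} \<longleftrightarrow> range \<nu> \<subseteq> {p, q}"
    "range (\<phi> \<nu>) \<subseteq> {h p, h r} \<longleftrightarrow> range \<nu> \<subseteq> {p, r}" if "\<nu> \<in> TRs_into \<A>" for \<nu>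
    using range_\<phi>_iff(2)[OF that, of "{p, q, r}"] range_\<phi>_iff(1)[OF that, of "{p, q}"]
      range_\<phi>_iff(1)[OF that, of "{p, r}"] assms by simp_all
  moreover have "B.decomposable (h p) (h q) (h r) \<longleftrightarrow>
    (\<forall>\<mu>\<in>TRs_into \<A>. \<forall>\<nu>\<in>TRs_into \<A>. range (\<phi> \<mu>) = {h p, h q, h r} \<longrightarrow>
     (\<forall>\<rho>\<in>TRs_into \<A>. tr_le (\<phi> \<rho>) (\<phi> \<mu>) \<longrightarrow>
        range (\<phi> \<rho>) \<subseteq> {h p, h q} \<or> range (\<phi> \<rho>) \<subseteq> {h p, h r} \<longrightarrow> tr_le (\<phi> \<rho>) (\<phi> \<nu>)) \<longrightarrow>
     tr_le (\<phi> \<mu>) (\<phi> \<nu>))"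
  proof -
    define S where "S \<mu> \<nu> \<rho> \<longleftrightarrow> (tr_le \<rho> \<mu> \<longrightarrow>
      range \<rho> \<subseteq> {h p, h q} \<or> range \<rho> \<subseteq> {h p, h r} \<longrightarrow> tr_le \<rho> \<nu>)" for \<mu> \<nu> \<rho>
    define T where "T \<mu> \<nu> \<longleftrightarrow> (range \<mu> = {h p, h q, h r} \<longrightarrow>
      (\<forall>\<rho>\<in>TRs_into \<B>. S \<mu> \<nu> \<rho>) \<longrightarrow> tr_le \<mu> \<nu>)" for \<mu> \<nu>
    have S_cong: "S \<mu> \<nu> \<rho> \<longleftrightarrow> S \<mu> \<nu> \<rho>'" if "tr_le \<rho> \<rho>'" "tr_le \<rho>' \<rho>" for \<mu> \<nu> \<rho> \<rho>'
      unfolding S_def tr_le_cong[OF that] by (rule refl)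
    \<comment> \<open>The inner quantifier is moved separately, for arbitrary \<open>\<mu>\<close>
      and \<open>\<nu>\<close>; the two outer ones follow by invariance of \<open>T\<close>.\<close>
    have S: "(\<forall>\<rho>\<in>TRs_into \<B>. S \<mu> \<nu> \<rho>) \<longleftrightarrow> (\<forall>\<rho>\<in>TRs_into \<A>. S \<mu> \<nu> (\<phi> \<rho>))" for \<mu> \<nu>
      by (rule ball_TRs_into) (erule (1) S_cong)
    have T_cong: "T \<mu> \<sigma> \<longleftrightarrow> T \<mu>' \<sigma>" "T \<sigma> \<mu> \<longleftrightarrow> T \<sigma> \<mu>'" if "tr_le \<mu> \<mu>'" "tr_le \<mu>' \<mu>" for \<mu> \<mu>' \<sigma>
      unfolding T_def S_def tr_le_cong[OF that] by (rule refl)+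
    have "B.decomposable (h p) (h q) (h r) \<longleftrightarrow> (\<forall>\<mu>\<in>TRs_into \<B>. \<forall>\<nu>\<in>TRs_into \<B>. T \<mu> \<nu>)"
      unfolding B.decomposable_def T_def S_def ..
    also have "\<dots> \<longleftrightarrow> (\<forall>\<mu>\<in>TRs_into \<A>. \<forall>\<nu>\<in>TRs_into \<A>. T (\<phi> \<mu>) (\<phi> \<nu>))"
      by (rule ball_ball_TRs_into) (erule (1) T_cong(1), erule (1) T_cong(2))
    finally show ?thesis unfolding T_def S unfolding S_def .
  qed
  ultimately show ?thesis unfolding A.decomposable_def using le_iff by simp
qed

lemma isomorphic: "posets_isomorphic \<A> (\<subseteq>) \<B> (\<subseteq>)"
proof -
  have hB: "h p \<in> \<B>" if "p \<in> \<A>" for p using that by (rule \<phi>_const(2))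
  have inj: "inj_on h \<A>" using bij_h by (simp add: bij_betw_def)
  have cmp: "p \<subseteq> q \<or> q \<subseteq> p \<longleftrightarrow> h p \<subseteq> h q \<or> h q \<subseteq> h p" if pq: "p \<in> \<A>" "q \<in> \<A>" for p q
  proof (cases "p = q")
    case False
    then have "h p \<noteq> h q" using inj pq by (simp add: inj_on_eq_iff)
    then show ?thesis
      using A.two_valued_unique_iff[OF pq False] two_valued_unique_h[OF pq]
        B.two_valued_unique_iff[OF hB[OF pq(1)] hB[OF pq(2)]]
      by blast
  qed simp
  have "h p \<subseteq> h q" if pqr: "p \<in> \<A>" "q \<in> \<A>" "r \<in> \<A>" "\<not> q \<subseteq> r" "\<not> r \<subseteq> q" "p \<subseteq> q" "p \<subseteq> r" for p q r
  proof (rule ccontr)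
    assume "\<not> h p \<subseteq> h q"
    \<comment> \<open>Comparability gives the first inclusion. Were
      \<open>h p \<subseteq> h r\<close>, then \<open>h q \<subseteq> h r\<close> would follow,
      although \<open>h q\<close> and \<open>h r\<close> are incomparable.\<close>
    then have "h q \<subseteq> h p" "h r \<subseteq> h p" using cmp[of p q] cmp[of p r] cmp[of q r] pqr by blast+
    then have "B.decomposable (h p) (h q) (h r)"
      using B.cofork_decomposable cmp[of q r] pqr by blast
    then show False using A.fork_not_decomposable decomposable_h pqr by blast
  qed
  moreover have "h q \<subseteq> h p" if pqr: "p \<in> \<A>" "q \<in> \<A>" "r \<in> \<A>" "\<not> q \<subseteq> r" "\<not> r \<subseteq> q" "q \<subseteq> p" "r \<subseteq> p" for p q r
  proof (rule ccontr)
    assume "\<not> h q \<subseteq> h p"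
    then have "h p \<subseteq> h q" "h p \<subseteq> h r" using cmp[of p q] cmp[of p r] cmp[of q r] pqr by blast+
    then have "\<not> B.decomposable (h p) (h q) (h r)"
      using B.fork_not_decomposable cmp[of q r] pqr hB by blast
    then show False using A.cofork_decomposable decomposable_h pqr by blast
  qed
  \<comment> \<open>Inside a class of twins \<open>h\<close> is not known to preserve the direction
    of inclusions, so it is corrected by a permutation \<open>g\<close> of
    \<open>\<A>\<close>.\<close>
  ultimately obtain g where g: "bij_betw g \<A> \<A>"
    "\<And>p q. p \<in> \<A> \<Longrightarrow> q \<in> \<A> \<Longrightarrow> p \<subseteq> q \<longleftrightarrow> h (g p) \<subseteq> h (g q)"
    using same_comparability_isomorphic[OF A.fin, of "\<lambda>p. p" h] cmp inj by auto
  have "bij_betw (h \<circ> g) \<A> \<B>" using g(1) bij_h by (rule bij_betw_trans)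
  then show ?thesis unfolding posets_isomorphic_def using g(2) by (intro exI[of _ "h \<circ> g"]) simp
qed

end

section \<open>From isomorphic families to isomorphic degrees, and the equivalence\<close>

lemma Lstar_isomorphic_iff:
  "posets_isomorphic (Lstar \<A>) (quotient_le tr_le) (Lstar \<B>) (quotient_le tr_le) \<longleftrightarrow>
    (\<exists>\<phi>. \<phi> ` TRs_into \<A> \<subseteq> TRs_into \<B> \<and>
      (\<forall>\<mu>\<in>TRs_into \<A>. \<forall>\<nu>\<in>TRs_into \<A>. tr_le \<mu> \<nu> \<longleftrightarrow> tr_le (\<phi> \<mu>) (\<phi> \<nu>)) \<and>
      (\<forall>\<rho>\<in>TRs_into \<B>. \<exists>\<nu>\<in>TRs_into \<A>. tr_le \<rho> (\<phi> \<nu>) \<and> tr_le (\<phi> \<nu>) \<rho>))"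
  unfolding Lstar_def
  by (rule posets_isomorphic_quotient_iff) (fact tr_le_refl tr_le_trans)+

lemma Lstar_isomorphic:
  assumes \<A>: "finite \<A>" "\<forall>U\<in>\<A>. open U" and \<B>: "finite \<B>" "\<forall>U\<in>\<B>. open U"
    and iso: "posets_isomorphic \<A> (\<subseteq>) \<B> (\<subseteq>)"
  shows "posets_isomorphic (Lstar \<A>) (quotient_le tr_le) (Lstar \<B>) (quotient_le tr_le)"
proof -
  obtain h where h: "bij_betw h \<A> \<B>" "\<forall>p\<in>\<A>. \<forall>q\<in>\<A>. p \<subseteq> q \<longleftrightarrow> h p \<subseteq> h q"
    using iso unfolding posets_isomorphic_def by (elim exE conjE)
  have inj: "inj_on h \<A>" and hB: "h ` \<A> = \<B>" using h(1) by (auto simp: bij_betw_def)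
  \<comment> \<open>As \<open>h\<close> preserves and reflects inclusion, the sets
    \<open>{b. \<nu> a \<subseteq> \<nu> b}\<close> are the same for \<open>\<nu>\<close> and
    \<open>h \<circ> \<nu>\<close>. The backward direction serves for surjectivity.\<close>
  have comp_iff: "h \<circ> \<nu> \<in> TRs_into \<B> \<longleftrightarrow> \<nu> \<in> TRs_into \<A>" if ran: "range \<nu> \<subseteq> \<A>" for \<nu>
  proof -
    have "\<nu> a \<in> \<A>" for a using ran by blast
    then show ?thesis unfolding TRs_into_iff[OF \<A>] TRs_into_iff[OF \<B>] using h(2) hB by auto
  qed
  have 1: "(\<circ>) h ` TRs_into \<A> \<subseteq> TRs_into \<B>"
  proof (rule image_subsetI)
    fix \<nu> assume "\<nu> \<in> TRs_into \<A>"
    moreover then have "range \<nu> \<subseteq> \<A>" using TRs_into_iff[OF \<A>] by simp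
    ultimately show "h \<circ> \<nu> \<in> TRs_into \<B>" using comp_iff by simp
  qed
  have 2: "tr_le \<mu> \<nu> \<longleftrightarrow> tr_le (h \<circ> \<mu>) (h \<circ> \<nu>)"
    if "\<mu> \<in> TRs_into \<A>" "\<nu> \<in> TRs_into \<A>" for \<mu> \<nu>
  proof -
    have "\<mu> a \<in> \<A>" "\<nu> a \<in> \<A>" for a using that TRs_into_iff[OF \<A>] by blast+
    \<comment> \<open>The same continuous reductions work on both sides, because \<open>h\<close> is
      injective on the values.\<close>
    then show ?thesis unfolding tr_le_def fun_eq_iff using inj by (simp add: inj_on_eq_iff)
  qed
  have 3: "\<exists>\<nu>\<in>TRs_into \<A>. tr_le \<rho> (h \<circ> \<nu>) \<and> tr_le (h \<circ> \<nu>) \<rho>" if \<rho>: "\<rho> \<in> TRs_into \<B>" for \<rho>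
  proof -
    define \<nu> where "\<nu> = inv_into \<A> h \<circ> \<rho>"
    have "\<rho> a \<in> h ` \<A>" for a using \<rho> TRs_into_iff[OF \<B>] hB by blast
    then have "range \<nu> \<subseteq> \<A>" "h \<circ> \<nu> = \<rho>"
      unfolding \<nu>_def by (auto simp: inv_into_into f_inv_into_f)
    moreover have "\<nu> \<in> TRs_into \<A>" using comp_iff[of \<nu>] calculation \<rho> by simp
    ultimately show ?thesis using tr_le_refl by (intro bexI[of _ \<nu>]) auto
  qed
  show ?thesis
    unfolding Lstar_isomorphic_iff by (intro exI[of _ "(\<circ>) h"] conjI ballI 1 2 3)
qed

theorem theorem9p2:
  fixes \<A> \<B> :: "baire set set"
  assumes "finite \<A>" "\<A> \<noteq> {}" "\<forall>U\<in>\<A>. open U"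
    and "finite \<B>" "\<B> \<noteq> {}" "\<forall>U\<in>\<B>. open U"
  shows "posets_isomorphic (Lstar \<A>) (quotient_le tr_le) (Lstar \<B>) (quotient_le tr_le)
     \<longleftrightarrow> posets_isomorphic \<A> (\<subseteq>) \<B> (\<subseteq>)"
proof
  assume "posets_isomorphic (Lstar \<A>) (quotient_le tr_le) (Lstar \<B>) (quotient_le tr_le)"
  then obtain \<phi> where \<phi>: "\<phi> ` TRs_into \<A> \<subseteq> TRs_into \<B>"
    "\<forall>\<mu>\<in>TRs_into \<A>. \<forall>\<nu>\<in>TRs_into \<A>. tr_le \<mu> \<nu> \<longleftrightarrow> tr_le (\<phi> \<mu>) (\<phi> \<nu>)"
    "\<forall>\<rho>\<in>TRs_into \<B>. \<exists>\<nu>\<in>TRs_into \<A>. tr_le \<rho> (\<phi> \<nu>) \<and> tr_le (\<phi> \<nu>) \<rho>"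
    unfolding Lstar_isomorphic_iff by (elim exE conjE)
  interpret degree_isomorphism \<A> \<B> \<phi>
    by unfold_locales (use assms \<phi> in blast)+
  show "posets_isomorphic \<A> (\<subseteq>) \<B> (\<subseteq>)" by (rule isomorphic)
next
  assume "posets_isomorphic \<A> (\<subseteq>) \<B> (\<subseteq>)"
  then show "posets_isomorphic (Lstar \<A>) (quotient_le tr_le) (Lstar \<B>) (quotient_le tr_le)"
    using Lstar_isomorphic assms by blast
qed

end
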